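(* Let $A(t,y,x)=\sum_{n\ge 0}t^n\sum_{\sigma\in\mathcal S_n(132)}y^{\mathrm{des}(\sigma)}x^{123\text{-mch}(\sigma)}$. Then $$A(t,y,x)=\frac{\sqrt{x^2 t^2+2 x t (t y-1)+t^2 (y-4) y-2 t y+1}+x t\left(2 t y^2-2 (t+1) y+1\right)-2 t^2 (y-1) y+t y-1}{2 t y (x (t y-1)-t y)},$$ and the coefficient of $t^nx^k$ in $A(t,1,x)$ is $$[t^nx^k]A(t,1,x)= \frac{1}{n+1} \sum_{i=0}^{\lfloor n/2\rfloor} \sum_{j=0}^{n+1-i} (-1)^{2j} \binom{n+1}{i} \binom{i+k-1}{k}\binom{2n-3i-2j-k}{n-i} .$$
   Context: $\mathcal S_n$ is the set of permutations of $\{1,\dots,n\}$ in one-line notation ($\mathcal S_0$ contains only the empty permutation, on which all statistics are $0$). For a word $w$ of distinct integers, $\mathrm{red}(w)$ replaces the $i$-th smallest letter by $i$. $\sigma\in\mathcal S_n$ avoids $\lambda\in\mathcal S_k$ (classical avoidance) if no (not necessarily contiguous) subsequence $\sigma_{i_1}\cdots\sigma_{i_k}$, $i_1<\dots<i_k$, has reduction $\lambda$; $\mathcal S_n(\lambda)$ is the set of such $\sigma$. $\gamma\text{-mch}(\sigma)$ is the number of $i$ with $\mathrm{red}(\sigma_i\sigma_{i+1}\cdots\sigma_{i+k-1})=\gamma$ for $\gamma\in\mathcal S_k$. $\mathrm{des}(\sigma)=|\{i:\sigma_i>\sigma_{i+1}\}|$. The square root is the power series in $t$ with constant term $1$. Here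 $\binom{i+k-1}{k}$ is the coefficient of $z^k$ in $(1-z)^{-i}$ (so it is $1$ for $i=k=0$), and $\binom{2n-3i-2j-k}{n-i}$ is $0$ when $2n-3i-2j-k<n-i$.
   Formalization: The printed coefficient formula is false (n=2, k=0 gives 10/3, but the coefficient is 2); the formal theorem replaces (-1)^{2j} by (-1)^j and inserts the factor binom(n+1-i, j), for all n and k; the closed form of A is unchanged. *)

theory Defs
  imports
    "HOL-Combinatorics.Multiset_Permutations"
    "HOL-Library.Sublist"
    "HOL-Computational_Algebra.Formal_Laurent_Series"
    "HOL-Computational_Algebra.Fraction_Field"
begin

text \<open>
  Permutations of \<open>{1..n}\<close> in one-line notation are the lists in
  \<open>permutations_of_set {1..n}\<close>; positions are counted from 0.
\<close>

definition red :: "nat list \<Rightarrow> nat list" where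
  "red w = map (\<lambda>a. card {b \<in> set w. b \<le> a}) w"

definition avoids :: "nat list \<Rightarrow> nat list \<Rightarrow> bool" where
  "avoids w p \<longleftrightarrow> \<not> (\<exists>u. subseq u w \<and> red u = p)"

definition avoiders :: "nat \<Rightarrow> nat list \<Rightarrow> nat list set" where
  "avoiders n p = {w \<in> permutations_of_set {1..n}. avoids w p}"

definition mch :: "nat list \<Rightarrow> nat list \<Rightarrow> nat" where
  "mch p w = card {i. i + length p \<le> length w \<and> red (take (length p) (drop i w)) = p}"

definition des :: "nat list \<Rightarrow> nat" where
  "des w = card {i. Suc i < length w \<and> w ! i > w ! Suc i}"

text \<open>
  The generating function as a power series in \<open>t\<close>, for weights \<open>y\<close> and \<open>x\<close> taken in an
  arbitrary commutative ring, so that \<open>y\<close> and \<open>x\<close> can be indeterminates and \<open>y\<close> can be set to 1.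
\<close>

definition gen_A :: "'a::comm_ring_1 \<Rightarrow> 'a \<Rightarrow> 'a fps" where
  "gen_A y x = Abs_fps (\<lambda>n. \<Sum>w\<in>avoiders n [1,3,2]. y ^ des w * x ^ mch [1,2,3] w)"

text \<open>The field of rational functions in two independent indeterminates over the rationals.\<close>

type_synonym ratfun = "rat poly poly fract"

definition ind_y :: ratfun where "ind_y = Fraction_Field.Fract [:[:0, 1:]:] 1"

definition ind_x :: ratfun where "ind_x = Fraction_Field.Fract [:0, 1:] 1"

definition fps_sqrt :: "'a::comm_ring_1 fps \<Rightarrow> 'a fps" where
  "fps_sqrt r = (THE s. s ^ 2 = r \<and> fps_nth s 0 = 1)"

text \<open>The coefficient of \<open>z^k\<close> in \<open>(1 - z)^(-i)\<close>, that is, \<open>i + k - 1\<close> choose \<open>k\<close>.\<close>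

definition multichoose :: "nat \<Rightarrow> nat \<Rightarrow> rat" where
  "multichoose i k = fps_nth (inverse ((1 - fps_X) ^ i)) k"

text \<open>The upper argument may be negative, in which case the value is 0 (unlike for \<open>gbinomial\<close>).\<close>

definition int_choose :: "int \<Rightarrow> nat \<Rightarrow> nat" where
  "int_choose a b = (if a < int b then 0 else nat a choose b)"

end

theory Submission
  imports Defs
begin

text \<open>
  A nonempty 132-avoiding permutation splits at its maximum as \<open>u m v\<close>, where every letter of \<open>u\<close>
  exceeds every letter of \<open>v\<close>. A match of 123 that ends in \<open>m\<close> exists iff \<open>u\<close> ends in an ascent, so
  with \<open>E\<close> the part of \<open>A\<close> coming from words that end in an ascent and \<open>P = A + (x - 1) E\<close>,
  \[A = 1 + t P (1 + y (A - 1)), \qquad E = t (P - 1) + t y P E.\]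
  Eliminating \<open>P\<close> and \<open>E\<close> gives a quadratic equation for \<open>A\<close>, whose solution is the closed form.
  At \<open>y = 1\<close> the quadratic reads \<open>A = \<phi>(t A)\<close> with \<open>\<phi>(z) = 1 + z + z\<^sup>2 / (1 - x z)\<close>, and Lagrange
  inversion gives the coefficients. They are compared as polynomials in \<open>x\<close> by evaluating at every
  rational \<open>x\<close>, which keeps the power series over a field.
\<close>


subsection \<open>Lagrange inversion\<close>

text \<open>As \<open>b\<close> has no constant term, \<open>b ^ m\<close> starts in degree
  \<open>m\<close>. One bound \<open>m <= n\<close> thus serves all coefficients up to
  \<open>n\<close>, and the two finite sums can be swapped.\<close>

lemma fps_compose_mult_nth:
  fixes a b c :: "'a::comm_ring_1 fps"
  assumes "fps_nth b 0 = 0"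
  shows "fps_nth ((a oo b) * c) n = (\<Sum>m\<le>n. fps_nth a m * fps_nth (b ^ m * c) n)"
proof -
  have "fps_nth (a oo b) i = (\<Sum>m\<le>n. fps_nth a m * fps_nth (b ^ m) i)" if "i \<le> n" for i
    unfolding fps_compose_nth atLeast0AtMost
    using that startsby_zero_power_prefix[OF assms] by (intro sum.mono_neutral_left) auto
  then have "fps_nth ((a oo b) * c) n =
      (\<Sum>i\<le>n. \<Sum>m\<le>n. fps_nth a m * (fps_nth (b ^ m) i * fps_nth c (n - i)))"
    by (simp add: fps_mult_nth atLeast0AtMost sum_distrib_right mult.assoc)
  also have "\<dots> = (\<Sum>m\<le>n. fps_nth a m * fps_nth (b ^ m * c) n)"
    by (subst sum.swap) (simp add: fps_mult_nth atLeast0AtMost sum_distrib_left)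
  finally show ?thesis .
qed

text \<open>With \<open>\<psi> = z / \<phi>\<close> this is the residue of
  \<open>\<psi>' / \<psi> ^ (p + 1)\<close>. For \<open>p > 0\<close> the product is
  \<open>\<phi> ^ p - z \<phi>' \<phi> ^ (p - 1)\<close>, and differentiating
  \<open>\<phi> ^ p\<close> shows that both terms have the same coefficient at
  \<open>z ^ p\<close>.\<close>

lemma fps_nth_power_mult_deriv_quotient:
  fixes \<phi> :: "'a::field_char_0 fps"
  assumes "fps_nth \<phi> 0 \<noteq> 0"
  shows "fps_nth (\<phi> ^ Suc p * fps_deriv (fps_X * inverse \<phi>)) p = (if p = 0 then 1 else 0)"
proof (cases p)
  case 0
  then show ?thesis using assms by simp
next
  case (Suc q)
  have inv: "\<phi> * inverse \<phi> = 1"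
    using inverse_mult_eq_1'[OF assms] .
  have "fps_deriv (fps_X * inverse \<phi>) = inverse \<phi> - fps_X * fps_deriv \<phi> * inverse \<phi> ^ 2"
    using assms by (simp add: fps_inverse_deriv)
  then have "\<phi> ^ Suc p * fps_deriv (fps_X * inverse \<phi>) =
      \<phi> ^ Suc p * (inverse \<phi> - fps_X * fps_deriv \<phi> * inverse \<phi> ^ 2)"
    by (rule arg_cong)
  also have "\<dots> = \<phi> ^ p * (\<phi> * inverse \<phi>) - fps_X * fps_deriv \<phi> * \<phi> ^ q * (\<phi> * inverse \<phi>) ^ 2"
    by (simp add: Suc algebra_simps power2_eq_square)
  also have "\<dots> = \<phi> ^ p - fps_X * (fps_deriv \<phi> * \<phi> ^ q)"
    by (simp add: inv mult.assoc)
  finally have eq: "fps_nth (\<phi> ^ Suc p * fps_deriv (fps_X * inverse \<phi>)) p =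
      fps_nth (\<phi> ^ p) p - fps_nth (fps_deriv \<phi> * \<phi> ^ q) q"
    by (simp add: Suc)
  have "of_nat (Suc q) * fps_nth (\<phi> ^ Suc q) (Suc q) = fps_nth (fps_deriv (\<phi> ^ Suc q)) q"
    by (simp only: fps_deriv_nth Suc_eq_plus1)
  also have "\<dots> = fps_nth (fps_const (of_nat (Suc q)) * (fps_deriv \<phi> * \<phi> ^ q)) q"
    by (simp only: fps_deriv_power diff_Suc_1 mult.assoc)
  also have "\<dots> = of_nat (Suc q) * fps_nth (fps_deriv \<phi> * \<phi> ^ q) q"
    by (rule fps_mult_left_const_nth)
  finally have "fps_nth (\<phi> ^ p) p = fps_nth (fps_deriv \<phi> * \<phi> ^ q) q"
    using Suc by (simp del: of_nat_Suc power_Suc fps_deriv_nth)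
  then show ?thesis
    unfolding eq using Suc by simp
qed

text \<open>The equation makes \<open>F\<close> the compositional inverse of
  \<open>\<psi> = z / \<phi>\<close>, so \<open>(F' o \<psi>) \<psi>' = 1\<close>. Inserting this
  unit next to \<open>\<phi> ^ (n + 1)\<close> and expanding \<open>F'\<close> in powers of
  \<open>\<psi>\<close> leaves residues, of which only the one with \<open>m = n\<close> is
  nonzero.\<close>

theorem fps_lagrange_inversion:
  fixes F \<phi> :: "'a::field_char_0 fps"
  assumes F: "F = fps_X * (\<phi> oo F)" and \<phi>0: "fps_nth \<phi> 0 \<noteq> 0"
  shows "of_nat (Suc n) * fps_nth F (Suc n) = fps_nth (\<phi> ^ Suc n) n"
proof -
  define \<psi> where "\<psi> = fps_X * inverse \<phi>"
  have F0: "fps_nth F 0 = 0"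
    by (subst F) simp
  have F1: "fps_nth F 1 \<noteq> 0"
    by (subst F) (simp add: \<phi>0)
  have \<psi>0: "fps_nth \<psi> 0 = 0"
    by (simp add: \<psi>_def)
  have "\<psi> oo F = F * inverse (\<phi> oo F)"
    using F0 \<phi>0 by (simp add: \<psi>_def fps_compose_mult_distrib fps_inverse_compose)
  also have "\<dots> = fps_X * ((\<phi> oo F) * inverse (\<phi> oo F))"
    by (subst F) (simp add: mult.assoc)
  also have "\<dots> = fps_X"
    using \<phi>0 by (simp add: inverse_mult_eq_1')
  finally have "\<psi> oo F = fps_X" .
  then have "\<psi> = fps_inv F"
    by (metis F0 F1 fps_X_fps_compose_startby0 fps_compose_assoc fps_inv_right fps_compose_fps_X
        fps_inv_def fps_nth_Abs_fps compinv.simps(1) fps_X_nth zero_neq_one)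
  then have "F oo \<psi> = fps_X"
    using fps_inv_right[OF F0 F1] by simp
  then have "(fps_deriv F oo \<psi>) * fps_deriv \<psi> = 1"
    using fps_compose_deriv[OF \<psi>0, of F] by simp
  then have "fps_nth (\<phi> ^ Suc n) n = fps_nth ((fps_deriv F oo \<psi>) * (fps_deriv \<psi> * \<phi> ^ Suc n)) n"
    by (simp add: mult.assoc[symmetric])
  also have "\<dots> = (\<Sum>m\<le>n. fps_nth (fps_deriv F) m * fps_nth (\<psi> ^ m * (fps_deriv \<psi> * \<phi> ^ Suc n)) n)"
    by (rule fps_compose_mult_nth[OF \<psi>0])
  also have "\<dots> = (\<Sum>m\<le>n. fps_nth (fps_deriv F) m * (if m = n then 1 else 0))"
  proof (intro sum.cong refl arg_cong2[where f = "(*)"])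
    fix m assume "m \<in> {..n}"
    then have m: "m \<le> n" by simp
    \<comment> \<open>The factor \<open>\<psi> ^ m\<close> absorbs \<open>\<phi> ^ m\<close> and
      leaves \<open>z ^ m\<close>, so the residue lemma applies with
      \<open>p = n - m\<close>.\<close>
    have "\<psi> ^ m * \<phi> ^ m = fps_X ^ m"
      using \<phi>0 by (simp add: \<psi>_def power_mult_distrib[symmetric] mult.assoc inverse_mult_eq_1)
    moreover have "\<phi> ^ Suc n = \<phi> ^ m * \<phi> ^ Suc (n - m)"
      using m by (simp add: power_add[symmetric] del: power_Suc)
    moreover have "\<psi> ^ m * (fps_deriv \<psi> * (\<phi> ^ m * \<phi> ^ Suc (n - m))) =
        (\<psi> ^ m * \<phi> ^ m) * (\<phi> ^ Suc (n - m) * fps_deriv \<psi>)"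
      by (simp only: mult_ac)
    ultimately have "\<psi> ^ m * (fps_deriv \<psi> * \<phi> ^ Suc n) = fps_X ^ m * (\<phi> ^ Suc (n - m) * fps_deriv \<psi>)"
      by argo
    then have "fps_nth (\<psi> ^ m * (fps_deriv \<psi> * \<phi> ^ Suc n)) n =
        fps_nth (fps_X ^ m * (\<phi> ^ Suc (n - m) * fps_deriv \<psi>)) n"
      by (rule arg_cong)
    also have "\<dots> = fps_nth (\<phi> ^ Suc (n - m) * fps_deriv \<psi>) (n - m)"
      using m by (simp add: fps_X_power_mult_nth del: power_Suc)
    also have "\<dots> = (if m = n then 1 else 0)"
      unfolding \<psi>_def using fps_nth_power_mult_deriv_quotient[OF \<phi>0] m by auto
    finally show "fps_nth (\<psi> ^ m * (fps_deriv \<psi> * \<phi> ^ Suc n)) n = (if m = n then 1 else 0)" .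
  qed
  also have "\<dots> = of_nat (Suc n) * fps_nth F (Suc n)"
    by (simp add: if_distrib cong: if_cong)
  finally show ?thesis by simp
qed

subsection \<open>Words split at their maximum\<close>

text \<open>Splitting a triple into its first letter and a pair of the tail lets
  \<open>sorted_wrt_append\<close> handle concatenations.\<close>

fun avoids132 :: "nat list \<Rightarrow> bool" where
  "avoids132 [] \<longleftrightarrow> True"
| "avoids132 (a # w) \<longleftrightarrow> sorted_wrt (\<lambda>b c. \<not> (a < c \<and> c < b)) w \<and> avoids132 w"

fun ends_asc :: "nat list \<Rightarrow> bool" where
  "ends_asc (a # b # c # w) = ends_asc (b # c # w)"
| "ends_asc [a, b] \<longleftrightarrow> a < b"
| "ends_asc _ \<longleftrightarrow> False"

section \<open>Patterns of length three as inequalities between letters\<close>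

lemma sorted_wrt_iff_subseq: "sorted_wrt R w \<longleftrightarrow> (\<forall>b c. subseq [b, c] w \<longrightarrow> R b c)"
proof (induction w)
  case (Cons a w)
  have "c \<in> set w" if "subseq [b, c] w" for b c
    using subseq_Cons'[OF that] by (simp add: subseq_singleton_left)
  then have "(\<forall>b c. subseq [b, c] (a # w) \<longrightarrow> R b c) \<longleftrightarrow>
      (\<forall>c\<in>set w. R a c) \<and> (\<forall>b c. subseq [b, c] w \<longrightarrow> R b c)"
    by (auto simp: subseq_singleton_left)
  with Cons.IH show ?case by simp
qed simp

lemma avoids132_iff_subseq: "avoids132 w \<longleftrightarrow> \<not> (\<exists>a b c. subseq [a, b, c] w \<and> a < c \<and> c < b)"
proof (induction w)
  case (Cons d w)
  have "subseq [b, c] w" if "subseq [a, b, c] w" for a b c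
    using subseq_Cons'[OF that] .
  then have "(\<exists>a b c. subseq [a, b, c] (d # w) \<and> a < c \<and> c < b) \<longleftrightarrow>
      (\<exists>b c. subseq [b, c] w \<and> d < c \<and> c < b) \<or> (\<exists>a b c. subseq [a, b, c] w \<and> a < c \<and> c < b)"
    unfolding subseq_Cons2_iff by metis
  with Cons.IH show ?case by (simp add: sorted_wrt_iff_subseq) blast
qed simp

text \<open>Ranks are taken in the set of letters, so a rank 3 needs three different letters. This
  disposes of words with repetitions.\<close>

lemma distinct_if_3_in_red:
  assumes "3 \<in> set (red [a, b, c])"
  shows "distinct [a, b, c]"
proof (rule ccontr)
  assume "\<not> distinct [a, b, c]"
  then have "card {a, b, c} \<le> 2"
    by (auto simp: card_insert_if)
  moreover have "card {d \<in> {a, b, c}. d \<le> e} \<le> card {a, b, c}" for e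
    by (rule card_mono) auto
  moreover obtain e where "card {d \<in> {a, b, c}. d \<le> e} = 3"
    using assms by (auto simp: red_def)
  ultimately show False
    by (metis Suc_n_not_le_n numeral_2_eq_2 numeral_3_eq_3 order_trans)
qed

lemma red_distinct3:
  assumes "distinct [a, b, c]"
  shows "red [a, b, c] = map (\<lambda>e. of_bool (a \<le> e) + of_bool (b \<le> e) + of_bool (c \<le> e)) [a, b, c]"
proof -
  have "card {d \<in> {a, b, c}. d \<le> e} = of_bool (a \<le> e) + of_bool (b \<le> e) + of_bool (c \<le> e)" for e
  proof -
    have "card {d \<in> {a, b, c}. d \<le> e} = (\<Sum>d\<in>{a, b, c}. of_bool (d \<le> e))"
      by (simp only: card_eq_sum sum.inter_filter finite.intros of_bool_def)
    then show ?thesis using assms by simp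
  qed
  then show ?thesis by (simp add: red_def)
qed

lemma red3_eq_132_iff: "red [a, b, c] = [1, 3, 2] \<longleftrightarrow> a < c \<and> c < b"
proof (cases "distinct [a, b, c]")
  case True
  then consider "a < b" "b < c" | "a < c" "c < b" | "b < a" "a < c" | "b < c" "c < a"
    | "c < a" "a < b" | "c < b" "b < a"
    by fastforce
  then show ?thesis
    by cases (simp_all add: red_distinct3[OF True])
next
  case False
  then have "red [a, b, c] \<noteq> [1, 3, 2]"
    using distinct_if_3_in_red[of a b c] by force
  with False show ?thesis by auto
qed

lemma red3_eq_123_iff: "red [a, b, c] = [1, 2, 3] \<longleftrightarrow> a < b \<and> b < c"
proof (cases "distinct [a, b, c]")
  case True
  then consider "a < b" "b < c" | "a < c" "c < b" | "b < a" "a < c" | "b < c" "c < a"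
    | "c < a" "a < b" | "c < b" "b < a"
    by fastforce
  then show ?thesis
    by cases (simp_all add: red_distinct3[OF True])
next
  case False
  then have "red [a, b, c] \<noteq> [1, 2, 3]"
    using distinct_if_3_in_red[of a b c] by force
  with False show ?thesis by auto
qed

lemma avoids_132_iff: "avoids w [1, 3, 2] \<longleftrightarrow> avoids132 w"
proof -
  have "(\<exists>u. subseq u w \<and> red u = [1, 3, 2]) \<longleftrightarrow> (\<exists>a b c. subseq [a, b, c] w \<and> red [a, b, c] = [1, 3, 2])"
  proof
    assume "\<exists>u. subseq u w \<and> red u = [1, 3, 2]"
    then obtain u where u: "subseq u w" "red u = [1, 3, 2]" by blast
    moreover have "length (red u) = length u" by (simp add: red_def)
    ultimately have "length u = Suc (Suc (Suc 0))" by simp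
    then obtain a b c where "u = [a, b, c]" by (auto simp only: length_Suc_conv length_0_conv)
    with u show "\<exists>a b c. subseq [a, b, c] w \<and> red [a, b, c] = [1, 3, 2]" by blast
  qed blast
  then show ?thesis
    unfolding avoids_def red3_eq_132_iff avoids132_iff_subseq by simp
qed

section \<open>Recursions in the first letter for descents and matches\<close>

lemma card_Suc_shift:
  fixes Q :: "nat \<Rightarrow> bool"
  assumes "finite {i. Q i}"
  shows "card {i. Q i} = of_bool (Q 0) + card {i. Q (Suc i)}"
proof -
  have "{i. Q i} = {i. i = 0 \<and> Q 0} \<union> Suc ` {i. Q (Suc i)}"
  proof (rule set_eqI)
    fix i show "i \<in> {i. Q i} \<longleftrightarrow> i \<in> {i. i = 0 \<and> Q 0} \<union> Suc ` {i. Q (Suc i)}"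
      by (cases i) auto
  qed
  moreover have "finite {i. Q (Suc i)}"
    using finite_vimageI[OF assms, of Suc] by (simp add: vimage_def)
  ultimately show ?thesis
    by (simp add: card_Un_disjoint card_image disjoint_iff)
qed

lemma des_simps:
  "des [] = 0" "des [a] = 0"
  "des (a # b # w) = of_bool (b < a) + des (b # w)"
proof -
  have "finite {i. Suc i < length (a # b # w) \<and> (a # b # w) ! i > (a # b # w) ! Suc i}"
    by (rule finite_subset[of _ "{..length (a # b # w)}"]) auto
  from card_Suc_shift[OF this] show "des (a # b # w) = of_bool (b < a) + des (b # w)"
    by (simp add: des_def)
qed (simp_all add: des_def)

lemma mch_Nil: "p \<noteq> [] \<Longrightarrow> mch p [] = 0"
  by (simp add: mch_def)

lemma mch_Cons:
  assumes "p \<noteq> []"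
  shows "mch p (a # w) =
    of_bool (length p \<le> length (a # w) \<and> red (take (length p) (a # w)) = p) + mch p w"
proof -
  have "finite {i. i + length p \<le> length (a # w) \<and> red (take (length p) (drop i (a # w))) = p}"
    by (rule finite_subset[of _ "{..length (a # w)}"]) auto
  from card_Suc_shift[OF this] show ?thesis
    by (simp add: mch_def)
qed

definition mch123 :: "nat list \<Rightarrow> nat" where
  "mch123 = mch [1, 2, 3]"

lemma mch123_simps:
  "mch123 [] = 0" "mch123 [a] = 0" "mch123 [a, b] = 0"
  "mch123 (a # b # c # w) = of_bool (a < b \<and> b < c) + mch123 (b # c # w)"
proof -
  show 0: "mch123 [] = 0" by (simp add: mch123_def mch_Nil)
  show 1: "mch123 [a] = 0" for a
    using 0 mch_Cons[of "[1, 2, 3]" a "[]"] by (simp add: mch123_def)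
  show "mch123 [a, b] = 0"
    using 1[of b] mch_Cons[of "[1, 2, 3]" a "[b]"] by (simp add: mch123_def)
  define p where "p = [1, 2, 3::nat]"
  have "length p \<le> length (a # b # c # w)" "take (length p) (a # b # c # w) = [a, b, c]" "p \<noteq> []"
    by (simp_all add: p_def)
  moreover have "red [a, b, c] = p \<longleftrightarrow> a < b \<and> b < c"
    unfolding p_def by (rule red3_eq_123_iff)
  ultimately show "mch123 (a # b # c # w) = of_bool (a < b \<and> b < c) + mch123 (b # c # w)"
    using mch_Cons[of p a "b # c # w"] unfolding mch123_def p_def[symmetric] by (simp only: simp_thms)
qed

text \<open>Avoiding 132 forces every letter before the maximum to exceed every letter after it.
  Raising \<open>u\<close> by the length of \<open>v\<close> therefore lets both parts be
  permutations of initial segments.\<close>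

definition join132 :: "nat \<Rightarrow> nat list \<Rightarrow> nat list \<Rightarrow> nat list" where
  "join132 n u v = map (\<lambda>a. a + length v) u @ Suc n # v"

section \<open>Statistics of a word around its maximum\<close>

lemma des_Cons_max: "\<forall>b\<in>set v. b < m \<Longrightarrow> des (m # v) = des v + of_bool (v \<noteq> [])"
  by (cases v) (auto simp: des_simps)

lemma mch_Cons_max: "\<forall>b\<in>set v. b < m \<Longrightarrow> mch123 (m # v) = mch123 v"
  by (cases v rule: ends_asc.cases) (auto simp: mch123_simps)

lemma ends_asc_Cons_max: "\<forall>b\<in>set v. b < m \<Longrightarrow> ends_asc (m # v) = ends_asc v"
  by (cases v rule: ends_asc.cases) auto

lemma des_append_max:
  assumes "\<forall>a\<in>set u. a < m" "\<forall>b\<in>set v. b < m"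
  shows "des (u @ m # v) = des u + des v + of_bool (v \<noteq> [])"
  using assms(1)
proof (induction u rule: induct_list012)
  case 1
  then show ?case using des_Cons_max[OF assms(2)] by (simp add: des_simps)
next
  case (2 a)
  then show ?case using des_Cons_max[OF assms(2)] by (simp add: des_simps)
qed (simp add: des_simps)

text \<open>Of the windows that contain \<open>m\<close>, only the one ending in \<open>m\<close>
  can increase, and it does iff \<open>u\<close> ends in an ascent; in the others \<open>m\<close>
  is followed by a smaller letter.\<close>

lemma mch_append_max:
  assumes "\<forall>a\<in>set u. a < m" "\<forall>b\<in>set v. b < m"
  shows "mch123 (u @ m # v) = mch123 u + of_bool (ends_asc u) + mch123 v"
  using assms(1)
proof (induction u rule: ends_asc.induct)
  case (1 a b c w)
  then show ?case by (simp add: mch123_simps(4))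
next
  case (2 a b)
  have "mch123 (b # m # v) = mch123 (m # v)"
    using assms by (cases v) (auto simp: mch123_simps)
  with 2 show ?case using mch_Cons_max[OF assms(2)] by (simp add: mch123_simps)
next
  case "3_1"
  then show ?case using mch_Cons_max[OF assms(2)] by (simp add: mch123_simps)
next
  case ("3_2" a)
  have "mch123 (a # m # v) = mch123 (m # v)"
    using assms by (cases v) (auto simp: mch123_simps)
  then show ?case using mch_Cons_max[OF assms(2)] by (simp add: mch123_simps)
qed

text \<open>If \<open>v\<close> is nonempty, the step from \<open>m\<close> into \<open>v\<close> is
  a descent, so \<open>v\<close> alone decides. This fits a one-letter \<open>v\<close>, where
  \<open>ends_asc\<close> is false.\<close>

lemma ends_asc_append_max:
  assumes "\<forall>a\<in>set u. a < m" "\<forall>b\<in>set v. b < m"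
  shows "ends_asc (u @ m # v) \<longleftrightarrow> (if v = [] then u \<noteq> [] else ends_asc v)"
  using assms(1)
proof (induction u rule: induct_list012)
  case 1
  then show ?case using ends_asc_Cons_max[OF assms(2)] by (cases v) auto
next
  case (2 a)
  then show ?case using ends_asc_Cons_max[OF assms(2)] by (cases v) auto
next
  case (3 a b w)
  then show ?case by (cases w) auto
qed

lemma sorted_wrtI: "(\<And>a b. a \<in> set w \<Longrightarrow> b \<in> set w \<Longrightarrow> R a b) \<Longrightarrow> sorted_wrt R w"
  by (induction w) auto

text \<open>A letter \<open>a\<close> of \<open>u\<close>, then \<open>m\<close>, then a letter of
  \<open>v\<close> above \<open>a\<close> would form 132. If there is no such pair, a pattern that
  begins in \<open>u\<close> cannot end in \<open>v\<close>, and \<open>m\<close> is too large to be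
  the first or last letter of a pattern.\<close>

lemma avoids132_append_max:
  assumes "\<forall>a\<in>set u. a < m" "\<forall>b\<in>set v. b < m"
  shows "avoids132 (u @ m # v) \<longleftrightarrow> avoids132 u \<and> avoids132 v \<and> (\<forall>a\<in>set u. \<forall>b\<in>set v. b \<le> a)"
  using assms(1)
proof (induction u)
  case Nil
  have "sorted_wrt (\<lambda>b c. \<not> (m < c \<and> c < b)) v"
    using assms(2) by (intro sorted_wrtI) auto
  then show ?case by simp
next
  case (Cons a u)
  let ?R = "\<lambda>b c. \<not> (a < c \<and> c < b)"
  have "(\<forall>c\<in>set v. ?R m c) \<longleftrightarrow> (\<forall>b\<in>set v. b \<le> a)"
    using assms(2) by (auto simp: not_less)
  moreover have "sorted_wrt ?R v" if "\<forall>b\<in>set v. b \<le> a"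
    using that by (intro sorted_wrtI) auto
  moreover have "\<forall>b\<in>set u. \<forall>c\<in>set (m # v). ?R b c" if "\<forall>b\<in>set v. b \<le> a"
    using that Cons.prems by auto
  ultimately have "sorted_wrt ?R (u @ m # v) \<longleftrightarrow> sorted_wrt ?R u \<and> (\<forall>b\<in>set v. b \<le> a)"
    unfolding sorted_wrt_append sorted_wrt.simps by blast
  with Cons show ?case by auto
qed

lemma map_add_invariant:
  "des (map (\<lambda>a. a + k) w) = des w"
  "mch123 (map (\<lambda>a. a + k) w) = mch123 w"
  "ends_asc (map (\<lambda>a. a + k) w) = ends_asc w"
  "avoids132 (map (\<lambda>a. a + k) w) = avoids132 w"
proof -
  show "des (map (\<lambda>a. a + k) w) = des w"
    by (induction w rule: induct_list012) (auto simp: des_simps)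
  show "mch123 (map (\<lambda>a. a + k) w) = mch123 w"
    by (induction w rule: ends_asc.induct) (auto simp: mch123_simps)
  show "ends_asc (map (\<lambda>a. a + k) w) = ends_asc w"
    by (induction w rule: ends_asc.induct) auto
  show "avoids132 (map (\<lambda>a. a + k) w) = avoids132 w"
    by (induction w) (auto simp: sorted_wrt_map)
qed

subsection \<open>The decomposition of 132-avoiding permutations\<close>

definition avoiders132 :: "nat \<Rightarrow> nat list set" where
  "avoiders132 n = avoiders n [1, 3, 2]"

lemma mem_avoiders132: "w \<in> avoiders132 n \<longleftrightarrow> set w = {1..n} \<and> distinct w \<and> avoids132 w"
  by (simp only: avoiders132_def avoiders_def avoids_132_iff permutations_of_set_def mem_Collect_eq conj_assoc)

lemma finite_avoiders132: "finite (avoiders132 n)"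
  by (simp add: avoiders132_def avoiders_def)

lemma avoiders132_length: "w \<in> avoiders132 n \<Longrightarrow> length w = n"
  using distinct_card[of w] by (simp add: mem_avoiders132)

lemma avoiders132_0: "avoiders132 0 = {[]}"
proof -
  have "w \<in> avoiders132 0 \<longleftrightarrow> w = []" for w
    by (auto simp: mem_avoiders132)
  then show ?thesis by blast
qed

lemma join132_stats:
  assumes u: "u \<in> avoiders132 (n - k)" and v: "v \<in> avoiders132 k" and k: "k \<le> n"
  shows "des (join132 n u v) = des u + des v + of_bool (v \<noteq> [])"
    and "mch123 (join132 n u v) = mch123 u + of_bool (ends_asc u) + mch123 v"
    and "ends_asc (join132 n u v) \<longleftrightarrow> (if v = [] then u \<noteq> [] else ends_asc v)"
    and "join132 n u v \<in> avoiders132 (Suc n)"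
proof -
  let ?u = "map (\<lambda>a. a + length v) u"
  have len: "length v = k"
    using avoiders132_length[OF v] .
  have set_u: "set ?u = {Suc k..n}"
  proof -
    have "set ?u = (\<lambda>a. a + k) ` {1..n - k}"
      using u len by (simp add: mem_avoiders132)
    then show ?thesis using k by simp
  qed
  have set_v: "set v = {1..k}"
    using v by (simp add: mem_avoiders132)
  have bounds: "\<forall>a\<in>set ?u. a < Suc n" "\<forall>b\<in>set v. b < Suc n"
    unfolding set_u set_v using k by auto
  note max = des_append_max[OF bounds] mch_append_max[OF bounds] ends_asc_append_max[OF bounds]
    avoids132_append_max[OF bounds]
  show "des (join132 n u v) = des u + des v + of_bool (v \<noteq> [])"
    unfolding join132_def max map_add_invariant ..
  show "mch123 (join132 n u v) = mch123 u + of_bool (ends_asc u) + mch123 v"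
    unfolding join132_def max map_add_invariant ..
  show "ends_asc (join132 n u v) \<longleftrightarrow> (if v = [] then u \<noteq> [] else ends_asc v)"
    unfolding join132_def max map_add_invariant by simp
  have "avoids132 (join132 n u v)"
    unfolding join132_def max map_add_invariant set_u set_v
    using u v by (auto simp: mem_avoiders132)
  moreover have "set (join132 n u v) = {1..Suc n}"
    unfolding join132_def set_append list.set set_u set_v using k by auto
  moreover have "distinct (join132 n u v)"
    unfolding join132_def distinct_append distinct.simps list.set set_u set_v
    using u v k by (auto simp: mem_avoiders132 distinct_map inj_on_def)
  ultimately show "join132 n u v \<in> avoiders132 (Suc n)"
    by (simp add: mem_avoiders132)
qed

text \<open>No letter of \<open>v\<close> exceeds a letter of \<open>u'\<close>, so the letters of
  \<open>v\<close> form a lower segment of \<open>1..n\<close>; those of \<open>u'\<close> are the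
  rest and are lowered by \<open>k\<close>.\<close>

lemma avoiders132_split:
  assumes w: "w \<in> avoiders132 (Suc n)"
  obtains k u v where "k \<le> n" "u \<in> avoiders132 (n - k)" "v \<in> avoiders132 k"
    "w = join132 n u v"
proof -
  have "Suc n \<in> set w"
    using w by (simp add: mem_avoiders132)
  then obtain u' v where split: "w = u' @ Suc n # v"
    using split_list by metis
  have dist: "distinct u'" "distinct v" "set u' \<inter> set v = {}" "Suc n \<notin> set u'" "Suc n \<notin> set v"
    using w by (auto simp: mem_avoiders132 split)
  have ins: "insert (Suc n) (set u' \<union> set v) = insert (Suc n) {1..n}"
    using w by (auto simp: mem_avoiders132 split)
  have un: "set u' \<union> set v = {1..n}"
  proof -
    have "Suc n \<notin> set u' \<union> set v" "Suc n \<notin> {1..n}"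
      using dist(4,5) by simp_all
    from iffD1[OF insert_ident[OF this] ins] show ?thesis .
  qed
  have bounds: "\<forall>a\<in>set u'. a < Suc n" "\<forall>b\<in>set v. b < Suc n"
    using un by (metis Un_iff atLeastAtMost_iff le_imp_less_Suc)+
  have av: "avoids132 u'" "avoids132 v" and le: "\<And>a b. a \<in> set u' \<Longrightarrow> b \<in> set v \<Longrightarrow> b \<le> a"
    using w unfolding split mem_avoiders132 avoids132_append_max[OF bounds] by auto
  define k where "k = length v"
  have set_v: "set v = {1..k}"
  proof (cases "v = []")
    case False
    define m where "m = Max (set v)"
    have m: "m \<in> set v" "\<And>b. b \<in> set v \<Longrightarrow> b \<le> m"
      using False by (simp_all add: m_def)
    have "set v = {1..m}"
    proof (intro equalityI subsetI)
      fix b assume "b \<in> set v"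
      then have "b \<le> m" "b \<in> {1..n}" using m(2) un by blast+
      then show "b \<in> {1..m}" by simp
    next
      fix b assume b: "b \<in> {1..m}"
      have "m \<in> {1..n}" using un m(1) by blast
      then have "b \<in> {1..n}" using b by simp
      then have "b \<in> set u' \<or> b \<in> set v" using un by blast
      \<comment> \<open>Every letter of \<open>u'\<close> is at least the maximum \<open>m\<close>
        of \<open>v\<close>, so no number below \<open>m\<close> can lie in
        \<open>u'\<close>.\<close>
      moreover have "b = m" if "b \<in> set u'" using le[OF that m(1)] b by simp
      ultimately show "b \<in> set v" using m(1) by auto
    qed
    then show ?thesis using distinct_card[OF dist(2)] by (simp add: k_def)
  qed (simp add: k_def)
  have k: "k \<le> n"
  proof -
    have "{1..k} \<subseteq> {1..n}" using un set_v by blast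
    then show ?thesis by (cases k) auto
  qed
  have set_u: "set u' = {Suc k..n}"
  proof -
    have "set u' = {1..n} - {1..k}"
      using un set_v dist(3) by blast
    moreover have "a \<in> {1..n} - {1..k} \<longleftrightarrow> a \<in> {Suc k..n}" for a
      unfolding Diff_iff atLeastAtMost_iff by presburger
    ultimately show ?thesis by blast
  qed
  define u where "u = map (\<lambda>a. a - k) u'"
  have u': "u' = map (\<lambda>a. a + length v) u"
    unfolding u_def k_def[symmetric] map_map by (rule map_idI[symmetric]) (auto simp: set_u)
  have "set u = (\<lambda>a. a - k) ` {Suc k..n}"
    by (simp add: u_def set_u)
  also have "\<dots> = {1..n - k}"
  proof (intro equalityI subsetI)
    fix a assume "a \<in> {1..n - k}"
    then show "a \<in> (\<lambda>a. a - k) ` {Suc k..n}" using k by (intro image_eqI[of _ _ "a + k"]) auto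
  qed auto
  finally have "set u = {1..n - k}" .
  moreover have "distinct u"
    using dist(1) unfolding u' by (simp add: distinct_map)
  moreover have "avoids132 u"
    using av(1) unfolding u' map_add_invariant .
  ultimately have "u \<in> avoiders132 (n - k)"
    by (simp add: mem_avoiders132)
  moreover have "v \<in> avoiders132 k"
    using set_v dist(2) av(2) by (simp add: mem_avoiders132)
  moreover have "w = join132 n u v"
    unfolding join132_def split by (subst u') simp
  ultimately show thesis using that k by blast
qed

text \<open>The letter \<open>n + 1\<close> occurs once, so its place determines \<open>v\<close>
  and the raised \<open>u\<close>; then \<open>length v\<close> gives \<open>k\<close> and the
  amount of the raise.\<close>

lemma join132_inject:
  assumes u: "u \<in> avoiders132 (n - k)" and v: "v \<in> avoiders132 k" and k: "k \<le> n"
    and u': "u' \<in> avoiders132 (n - k')" and v': "v' \<in> avoiders132 k'" and k': "k' \<le> n"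
    and eq: "join132 n u v = join132 n u' v'"
  shows "k = k' \<and> u = u' \<and> v = v'"
proof -
  let ?shift = "\<lambda>v u. map (\<lambda>a. a + length v) u"
  have notin: "Suc n \<notin> set (?shift v u)" "Suc n \<notin> set v" 
    using u v k avoiders132_length[OF v] by (auto simp: mem_avoiders132)
  have "v' = v" "?shift v u = ?shift v' u'"
    using eq notin unfolding join132_def by (auto simp: append_Cons_eq_iff)
  moreover from this have "u = u'"
    by (simp add: inj_map_eq_map inj_def)
  ultimately show ?thesis
    using avoiders132_length[OF v] avoiders132_length[OF v'] by simp
qed

lemma sum_avoiders132_Suc:
  fixes W :: "nat list \<Rightarrow> 'a::comm_monoid_add"
  shows "(\<Sum>w\<in>avoiders132 (Suc n). W w) =
    (\<Sum>k\<le>n. \<Sum>u\<in>avoiders132 (n - k). \<Sum>v\<in>avoiders132 k. W (join132 n u v))"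
proof -
  let ?S = "SIGMA k:{..n}. avoiders132 (n - k) \<times> avoiders132 k"
  have "bij_betw (\<lambda>(k, u, v). join132 n u v) ?S (avoiders132 (Suc n))"
  proof (rule bij_betw_imageI)
    show "inj_on (\<lambda>(k, u, v). join132 n u v) ?S"
      unfolding inj_on_def by (auto dest: join132_inject)
    show "(\<lambda>(k, u, v). join132 n u v) ` ?S = avoiders132 (Suc n)"
    proof (intro equalityI subsetI)
      fix w assume "w \<in> avoiders132 (Suc n)"
      then obtain k u v where "k \<le> n" "u \<in> avoiders132 (n - k)" "v \<in> avoiders132 k"
        "w = join132 n u v"
        by (rule avoiders132_split)
      then show "w \<in> (\<lambda>(k, u, v). join132 n u v) ` ?S"
        by (intro image_eqI[of _ _ "(k, u, v)"]) auto
    qed (auto intro: join132_stats(4))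
  qed
  then have "(\<Sum>w\<in>avoiders132 (Suc n). W w) = (\<Sum>(k, u, v)\<in>?S. W (join132 n u v))"
    by (subst sum.reindex_bij_betw[symmetric]) (simp_all add: case_prod_unfold)
  also have "\<dots> = (\<Sum>k\<le>n. \<Sum>(u, v)\<in>avoiders132 (n - k) \<times> avoiders132 k. W (join132 n u v))"
    by (subst sum.Sigma) (auto simp: finite_avoiders132)
  finally show ?thesis
    by (simp add: sum.cartesian_product)
qed

section \<open>Weighted sums over avoiders and their functional equations\<close>

definition weight :: "'a::comm_ring_1 \<Rightarrow> 'a \<Rightarrow> nat list \<Rightarrow> 'a" where
  "weight y x w = y ^ des w * x ^ mch123 w"

text \<open>What \<open>u\<close> contributes to the weight of \<open>u m v\<close>: a final ascent
  of \<open>u\<close> becomes a match ending in \<open>m\<close>. Its series is the \<open>P\<close>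
  of the overview.\<close>

definition weight_before_max :: "'a::comm_ring_1 \<Rightarrow> 'a \<Rightarrow> nat list \<Rightarrow> 'a" where
  "weight_before_max y x w = weight y x w * (if ends_asc w then x else 1)"

definition weight_ends_asc :: "'a::comm_ring_1 \<Rightarrow> 'a \<Rightarrow> nat list \<Rightarrow> 'a" where
  "weight_ends_asc y x w = (if ends_asc w then weight y x w else 0)"

definition avoiders132_fps :: "(nat list \<Rightarrow> 'a::comm_ring_1) \<Rightarrow> 'a fps" where
  "avoiders132_fps W = Abs_fps (\<lambda>n. \<Sum>w\<in>avoiders132 n. W w)"

lemma gen_A_eq: "gen_A y x = avoiders132_fps (weight y x)"
  by (simp only: gen_A_def avoiders132_fps_def avoiders132_def weight_def mch123_def)

lemma weight_join132:
  assumes "u \<in> avoiders132 (n - k)" "v \<in> avoiders132 k" "k \<le> n"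
  shows "weight y x (join132 n u v) = weight_before_max y x u * (if v = [] then 1 else y * weight y x v)"
  using join132_stats[OF assms]
  by (simp add: weight_def weight_before_max_def power_add des_simps mch123_simps)

text \<open>A weight that factors over joins turns the decomposition into a product of series, with
  \<open>fps_X\<close> for the maximum and a constant for the empty word.\<close>

lemma avoiders132_fps_rec:
  fixes W F H :: "nat list \<Rightarrow> 'a::comm_ring_1"
  assumes "\<And>n k u v. u \<in> avoiders132 (n - k) \<Longrightarrow> v \<in> avoiders132 k \<Longrightarrow> k \<le> n \<Longrightarrow>
    W (join132 n u v) = F u * H v"
  shows "avoiders132_fps W = fps_const (W []) + fps_X * (avoiders132_fps F * avoiders132_fps H)"
proof (rule fps_ext)
  fix n
  show "fps_nth (avoiders132_fps W) n =
    fps_nth (fps_const (W []) + fps_X * (avoiders132_fps F * avoiders132_fps H)) n"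
  proof (cases n)
    case 0
    then show ?thesis by (simp add: avoiders132_fps_def avoiders132_0)
  next
    case (Suc m)
    have "fps_nth (avoiders132_fps W) n =
        (\<Sum>k\<le>m. \<Sum>u\<in>avoiders132 (m - k). \<Sum>v\<in>avoiders132 k. F u * H v)"
      unfolding avoiders132_fps_def Suc fps_nth_Abs_fps sum_avoiders132_Suc
      by (intro sum.cong refl) (simp add: assms)
    also have "\<dots> = (\<Sum>k\<le>m. fps_nth (avoiders132_fps F) (m - k) * fps_nth (avoiders132_fps H) k)"
      by (simp add: avoiders132_fps_def sum_product)
    also have "\<dots> = (\<Sum>k\<le>m. fps_nth (avoiders132_fps H) k * fps_nth (avoiders132_fps F) (m - k))"
      by (simp only: mult.commute)
    also have "\<dots> = fps_nth (avoiders132_fps F * avoiders132_fps H) m"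
      unfolding mult.commute[of "avoiders132_fps F"] fps_mult_nth atLeast0AtMost ..
    finally show ?thesis using Suc by simp
  qed
qed

lemma avoiders132_fps_add:
  "avoiders132_fps (\<lambda>w. F w + G w) = avoiders132_fps F + avoiders132_fps G"
  by (rule fps_ext) (simp add: avoiders132_fps_def sum.distrib)

text \<open>Only size 0 contains the empty word, so changing its weight affects the constant
  coefficient alone. This produces factors such as \<open>1 + y (A - 1)\<close>.\<close>

lemma avoiders132_fps_if_Nil:
  "avoiders132_fps (\<lambda>w. if w = [] then a else F w) = avoiders132_fps F + fps_const (a - F [])"
proof (rule fps_ext)
  fix n
  show "fps_nth (avoiders132_fps (\<lambda>w. if w = [] then a else F w)) n =
      fps_nth (avoiders132_fps F + fps_const (a - F [])) n"
  proof (cases n)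
    case 0
    then show ?thesis by (simp add: avoiders132_fps_def avoiders132_0)
  next
    case (Suc m)
    have "w \<noteq> []" if "w \<in> avoiders132 n" for w
      using avoiders132_length[OF that] Suc by auto
    then show ?thesis using Suc by (simp add: avoiders132_fps_def)
  qed
qed

lemma avoiders132_fps_cmult:
  "avoiders132_fps (\<lambda>w. c * F w) = fps_const c * avoiders132_fps F"
  by (rule fps_ext) (simp add: avoiders132_fps_def sum_distrib_left)

text \<open>The factor \<open>x\<close> for a final ascent is written as
  \<open>1 + (x - 1)\<close>.\<close>

lemma weight_before_max_fps:
  "avoiders132_fps (weight_before_max y x) =
    avoiders132_fps (weight y x) + fps_const (x - 1) * avoiders132_fps (weight_ends_asc y x)"
proof -
  have "weight_before_max y x = (\<lambda>w. weight y x w + (x - 1) * weight_ends_asc y x w)"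
    by (rule ext) (simp add: weight_before_max_def weight_ends_asc_def algebra_simps)
  then show ?thesis
    by (simp only: avoiders132_fps_add avoiders132_fps_cmult)
qed

lemma weight_Nil [simp]:
  "weight y x [] = 1" "weight_before_max y x [] = 1" "weight_ends_asc y x [] = 0"
  by (simp_all add: weight_def weight_before_max_def weight_ends_asc_def des_simps mch123_simps)

theorem weight_fps_rec:
  "avoiders132_fps (weight y x) = 1 + fps_X * (avoiders132_fps (weight_before_max y x) *
    (1 + fps_const y * (avoiders132_fps (weight y x) - 1)))"
proof -
  have "avoiders132_fps (weight y x) = fps_const (weight y x []) +
      fps_X * (avoiders132_fps (weight_before_max y x) *
        avoiders132_fps (\<lambda>v. if v = [] then 1 else y * weight y x v))"
    by (rule avoiders132_fps_rec) (rule weight_join132)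
  then show ?thesis
    unfolding avoiders132_fps_if_Nil avoiders132_fps_cmult
    by (simp add: algebra_simps fps_const_sub[symmetric] del: fps_const_sub)
qed

text \<open>The weight of a joined word is a product on each of the two classes of words, those that end in
  their maximum and those that do not.\<close>

theorem weight_ends_asc_fps_rec:
  "avoiders132_fps (weight_ends_asc y x) = fps_X * (avoiders132_fps (weight_before_max y x) - 1) +
    fps_X * (avoiders132_fps (weight_before_max y x) * (fps_const y * avoiders132_fps (weight_ends_asc y x)))"
proof -
  \<comment> \<open>In a permutation of \<open>1..n\<close> the maximum is the length, so the case
    \<open>v = []\<close> can be recognised from the joined word itself.\<close>
  define last_is_max :: "nat list \<Rightarrow> bool" where "last_is_max w \<longleftrightarrow> w \<noteq> [] \<and> last w = length w" for w
  have last: "last_is_max (join132 n u v) \<longleftrightarrow> v = []"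
    if "u \<in> avoiders132 (n - k)" "v \<in> avoiders132 k" "k \<le> n" for n k u v
  proof (cases "v = []")
    case True
    then have "k = 0"
      using avoiders132_length[OF that(2)] by simp
    with True show ?thesis
      using avoiders132_length[OF that(1)] by (simp add: last_is_max_def join132_def)
  next
    case False
    then have "last v \<in> {1..k}"
      using last_in_set[of v] that(2) unfolding mem_avoiders132 by metis
    then have "last v \<le> n"
      using that(3) by simp
    moreover have "length (join132 n u v) = Suc n"
      by (rule avoiders132_length) (rule join132_stats(4)[OF that])
    ultimately show ?thesis
      using False by (simp add: last_is_max_def) (simp add: join132_def)
  qed
  let ?E1 = "\<lambda>w. if last_is_max w then weight_ends_asc y x w else 0"
  let ?E2 = "\<lambda>w. if last_is_max w then 0 else weight_ends_asc y x w"
  \<comment> \<open>The second factor singles out \<open>v = []\<close> and has series 1; the first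
    drops \<open>u = []\<close>, since a one-letter word has no ascent.\<close>
  have "avoiders132_fps ?E1 = fps_const (?E1 []) +
      fps_X * (avoiders132_fps (\<lambda>u. if u = [] then 0 else weight_before_max y x u) *
        avoiders132_fps (\<lambda>v. if v = [] then 1 else 0))"
  proof (rule avoiders132_fps_rec)
    fix n k u v
    assume *: "u \<in> avoiders132 (n - k)" "v \<in> avoiders132 k" "k \<le> n"
    show "?E1 (join132 n u v) =
        (if u = [] then 0 else weight_before_max y x u) * (if v = [] then 1 else 0)"
      using weight_join132[OF *, of y x] join132_stats(3)[OF *] last[OF *]
      unfolding weight_ends_asc_def by (cases "u = []"; cases "v = []") simp_all
  qed
  moreover have "avoiders132_fps (\<lambda>v. 0) = (0 :: 'a fps)"
    by (rule fps_ext) (simp add: avoiders132_fps_def)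
  ultimately have E1: "avoiders132_fps ?E1 = fps_X * (avoiders132_fps (weight_before_max y x) - 1)"
    unfolding avoiders132_fps_if_Nil by (simp add: last_is_max_def fps_const_neg[symmetric] del: fps_const_neg)
  \<comment> \<open>For \<open>v = []\<close> both weights vanish, as the empty word does not end in
    an ascent; otherwise \<open>v\<close> decides, and the step down from the maximum contributes
    \<open>y\<close>.\<close>
  have "avoiders132_fps ?E2 = fps_const (?E2 []) +
      fps_X * (avoiders132_fps (weight_before_max y x) * avoiders132_fps (\<lambda>v. y * weight_ends_asc y x v))"
  proof (rule avoiders132_fps_rec)
    fix n k u v
    assume *: "u \<in> avoiders132 (n - k)" "v \<in> avoiders132 k" "k \<le> n"
    show "?E2 (join132 n u v) = weight_before_max y x u * (y * weight_ends_asc y x v)"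
      using weight_join132[OF *, of y x] join132_stats(3)[OF *] last[OF *]
      by (simp add: weight_ends_asc_def)
  qed
  then have E2: "avoiders132_fps ?E2 = fps_X * (avoiders132_fps (weight_before_max y x) *
      (fps_const y * avoiders132_fps (weight_ends_asc y x)))"
    unfolding avoiders132_fps_cmult by simp
  have "weight_ends_asc y x = (\<lambda>w. ?E1 w + ?E2 w)"
    by auto
  then have "avoiders132_fps (weight_ends_asc y x) = avoiders132_fps (\<lambda>w. ?E1 w + ?E2 w)"
    by simp
  then show ?thesis
    unfolding avoiders132_fps_add E1 E2 .
qed

subsection \<open>The closed form\<close>

text \<open>Multiplying \<open>P = A + (x - 1) E\<close> by \<open>1 - t y P\<close> makes the
  \<open>A\<close> and \<open>E\<close> terms polynomials in \<open>P\<close>, and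
  \<open>t P Q = A - 1\<close> then removes \<open>P\<close>. No division occurs, so this works in
  any commutative ring.\<close>

lemma weight_system_quadratic:
  fixes A P E t x y :: "'a::comm_ring_1"
  assumes A: "A = 1 + t * (P * (1 + y * (A - 1)))"
    and E: "E = t * (P - 1) + t * (P * (y * E))"
    and P: "P = A + (x - 1) * E"
  defines "Q \<equiv> 1 + y * (A - 1)"
  shows "A - 1 = t * Q ^ 2 + t * (x - y) * (A - 1) * Q - (x - 1) * t ^ 2 * Q ^ 2"
proof -
  have A': "A * (1 - t * y * P) = 1 + t * P * (1 - y)"
    using A by (simp add: algebra_simps)
  have E': "E * (1 - t * y * P) = t * (P - 1)"
    using E by (simp add: algebra_simps)
  have "P * (1 - t * y * P) = A * (1 - t * y * P) + (x - 1) * (E * (1 - t * y * P))"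
    by (subst P) (simp add: algebra_simps)
  then have P': "P - t * y * P ^ 2 = 1 + t * P * (1 - y) + (x - 1) * (t * (P - 1))"
    unfolding A' E' by (simp add: algebra_simps power2_eq_square)
  have PQ: "t * P * Q = A - 1"
    using A unfolding Q_def by (simp add: algebra_simps)
  \<comment> \<open>The left side is \<open>A - 1\<close>, because \<open>Q - y (A - 1) = 1\<close>;
    the factor \<open>t Q ^ 2\<close> lets every \<open>P\<close> be absorbed into
    \<open>t P Q\<close>.\<close>
  have "(A - 1) * Q - y * (A - 1) ^ 2 = t * Q ^ 2 * (P - t * y * P ^ 2)"
    unfolding PQ[symmetric] by (simp add: algebra_simps power2_eq_square)
  also have "\<dots> = t * Q ^ 2 + t * (1 - y) * (t * P * Q) * Q + (x - 1) * t * (t * P * Q) * Q - (x - 1) * t ^ 2 * Q ^ 2"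
    unfolding P' by (simp add: algebra_simps power2_eq_square)
  also have "\<dots> = t * Q ^ 2 + t * (x - y) * (A - 1) * Q - (x - 1) * t ^ 2 * Q ^ 2"
    unfolding PQ by (simp add: algebra_simps)
  finally show ?thesis
    by (simp add: Q_def algebra_simps power2_eq_square)
qed

theorem gen_A_quadratic:
  fixes y x :: "'a::comm_ring_1"
  defines "A \<equiv> gen_A y x" and "Q \<equiv> 1 + fps_const y * (gen_A y x - 1)"
  shows "A - 1 = fps_X * Q ^ 2 + fps_X * (fps_const x - fps_const y) * (A - 1) * Q
    - (fps_const x - 1) * fps_X ^ 2 * Q ^ 2"
  unfolding A_def Q_def gen_A_eq
proof (rule weight_system_quadratic)
  show "avoiders132_fps (weight_before_max y x) = avoiders132_fps (weight y x) +
      (fps_const x - 1) * avoiders132_fps (weight_ends_asc y x)"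
    using weight_before_max_fps[of y x] by (simp add: fps_const_sub[symmetric] del: fps_const_sub)
qed (rule weight_fps_rec weight_ends_asc_fps_rec)+

text \<open>Two candidates satisfy \<open>(s' - s) (s' + s) = 0\<close>, and \<open>s' + s\<close>
  has constant term 2, so the root is unique when 2 is nonzero.\<close>

lemma fps_sqrt_eqI:
  fixes s :: "'a::idom fps"
  assumes "(2::'a) \<noteq> 0" "s ^ 2 = r" "fps_nth s 0 = 1"
  shows "fps_sqrt r = s"
  unfolding fps_sqrt_def
proof (rule the_equality)
  fix s' assume s': "s' ^ 2 = r \<and> fps_nth s' 0 = 1"
  then have "fps_nth (s' + s) 0 \<noteq> 0"
    using assms by simp
  then have "s' + s \<noteq> 0"
    by (metis fps_zero_nth)
  moreover have "(s' - s) * (s' + s) = 0"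
    using s' assms(2) by (simp add: algebra_simps power2_eq_square)
  ultimately show "s' = s"
    by simp
qed (use assms in simp)

text \<open>Completing the square: with the quadratic written as
  \<open>a A ^ 2 + b A + c = 0\<close>, the base on the left is \<open>- (2 a A + b)\<close> and the
  right side is \<open>b ^ 2 - 4 a c\<close>.\<close>

lemma quadratic_discriminant_square:
  fixes A t x y :: "'a::comm_ring_1"
  defines "Q \<equiv> 1 + y * (A - 1)"
  assumes "A - 1 = t * Q ^ 2 + t * (x - y) * (A - 1) * Q - (x - 1) * t ^ 2 * Q ^ 2"
  shows "(2 * t * y * (x * (t * y - 1) - t * y) * A
      - (x * t * (2 * t * y ^ 2 - 2 * (t + 1) * y + 1) - 2 * t ^ 2 * (y - 1) * y + t * y - 1)) ^ 2
    = x ^ 2 * t ^ 2 + 2 * x * t * (t * y - 1) + t ^ 2 * (y - 4) * y - 2 * t * y + 1" (is "?S = ?disc")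
proof -
  have "?S - ?disc = - 4 * t * y * (x * (t * y - 1) - t * y) *
      (t * Q ^ 2 + t * (x - y) * (A - 1) * Q - (x - 1) * t ^ 2 * Q ^ 2 - (A - 1))"
    unfolding Q_def by (simp add: algebra_simps power2_eq_square)
  then show ?thesis
    using assms(2) by simp
qed

text \<open>The denominator has constant term 0 and no inverse among power series, so the quotient
  is formed among Laurent series.\<close>

theorem gen_A_closed_form:
  fixes y x :: "'a::field"
  assumes two: "(2::'a) \<noteq> 0" and y: "y \<noteq> 0" and x: "x \<noteq> 0"
  defines "t \<equiv> fps_X" and "Y \<equiv> fps_const y" and "X \<equiv> fps_const x"
  shows "fps_to_fls (gen_A y x) =
      fps_to_fls
        (fps_sqrt (X ^ 2 * t ^ 2 + 2 * X * t * (t * Y - 1) + t ^ 2 * (Y - 4) * Y - 2 * t * Y + 1)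
          + X * t * (2 * t * Y ^ 2 - 2 * (t + 1) * Y + 1) - 2 * t ^ 2 * (Y - 1) * Y + t * Y - 1)
      / fps_to_fls (2 * t * Y * (X * (t * Y - 1) - t * Y))"
    (is "_ = fps_to_fls (fps_sqrt ?disc + ?N1 - ?N2 + ?N3 - 1) / fps_to_fls ?D")
proof -
  let ?S = "?D * gen_A y x - (?N1 - ?N2 + ?N3 - 1)"
  have "?S ^ 2 = ?disc"
    unfolding t_def Y_def X_def
    by (rule quadratic_discriminant_square) (rule gen_A_quadratic)
  \<comment> \<open>This selects the sign of the root: \<open>?D\<close> vanishes at
    \<open>t = 0\<close>, and the rest of the numerator is -1 there.\<close>
  moreover have "fps_nth ?S 0 = 1"
    by (simp add: t_def)
  ultimately have "fps_sqrt ?disc = ?S"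
    using two by (intro fps_sqrt_eqI)
  then have eq: "fps_sqrt ?disc + ?N1 - ?N2 + ?N3 - 1 = ?D * gen_A y x"
    by simp
  have "?D \<noteq> 0"
  proof -
    have "fps_nth (X * (t * Y - 1) - t * Y) 0 \<noteq> 0"
      using x by (simp add: X_def t_def)
    then have "X * (t * Y - 1) - t * Y \<noteq> 0"
      by (metis fps_zero_nth)
    moreover have "(2 :: 'a fps) \<noteq> 0"
      using two by (metis fps_numeral_nth_0 fps_zero_nth)
    ultimately show ?thesis
      using y by (simp add: t_def Y_def)
  qed
  then have "fps_to_fls ?D \<noteq> 0"
    by (simp only: fps_to_fls_eq_0_iff not_False_eq_True)
  then show ?thesis
    unfolding eq fls_times_fps_to_fls by (rule nonzero_mult_div_cancel_left[symmetric])
qed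

lemma ratfun_indeterminates:
  "(2::ratfun) \<noteq> 0" "ind_y \<noteq> 0" "ind_x \<noteq> 0"
proof -
  have "(2::ratfun) = Fraction_Field.Fract 2 1"
    unfolding one_add_one[symmetric] One_fract_def by simp
  then show "(2::ratfun) \<noteq> 0"
    by (simp only: Zero_fract_def eq_fract)
qed (simp_all add: ind_y_def ind_x_def Zero_fract_def eq_fract)

subsection \<open>The coefficients\<close>

definition lagrange_kernel :: "rat \<Rightarrow> rat fps" where
  "lagrange_kernel c = 1 + fps_X + fps_X ^ 2 * inverse (1 - fps_const c * fps_X)"

text \<open>At \<open>y = 1\<close> one has \<open>Q = A\<close>. In terms of \<open>F = t A\<close>
  the quadratic becomes linear in the remaining \<open>A\<close>, and cancelling
  \<open>1 - c F\<close> leaves the kernel at \<open>F\<close>.\<close>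

lemma gen_A_fixed_point:
  "gen_A 1 c = lagrange_kernel c oo (fps_X * gen_A 1 c)"
proof -
  define A F where "A = gen_A 1 c" and "F = fps_X * A"
  let ?D = "1 - fps_const c * F"
  have F0: "fps_nth F 0 = 0"
    by (simp add: F_def)
  have "A - 1 = fps_X * A ^ 2 + fps_X * (fps_const c - 1) * (A - 1) * A
      - (fps_const c - 1) * fps_X ^ 2 * A ^ 2"
    using gen_A_quadratic[of 1 c] by (simp add: A_def)
  then have A: "A * ?D = (1 + F) * ?D + F ^ 2"
    by (simp add: F_def algebra_simps power2_eq_square)
  have "(1 - fps_const c * fps_X) oo F = ?D"
    using F0 by (simp add: fps_compose_sub_distrib fps_compose_mult_distrib)
  then have "lagrange_kernel c oo F = 1 + F + F ^ 2 * inverse ?D"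
    using F0 by (simp add: lagrange_kernel_def fps_compose_add_distrib fps_compose_mult_distrib
        fps_inverse_compose fps_compose_power[symmetric])
  moreover have "?D * inverse ?D = 1"
    using F0 by (intro inverse_mult_eq_1') simp
  ultimately have "(lagrange_kernel c oo F) * ?D = (1 + F) * ?D + F ^ 2"
    by (simp add: distrib_right mult.assoc mult.commute[of "inverse ?D"])
  with A have "A * ?D = (lagrange_kernel c oo F) * ?D"
    by simp
  moreover have "?D \<noteq> 0"
    using F0 by (metis \<open>?D * inverse ?D = 1\<close> mult_zero_left zero_neq_one)
  ultimately show ?thesis
    unfolding A_def F_def by simp
qed

lemma gen_A_nth_lagrange:
  "of_nat (Suc n) * fps_nth (gen_A 1 c) n = fps_nth (lagrange_kernel c ^ Suc n) n"
proof -
  have "fps_X * gen_A 1 c = fps_X * (lagrange_kernel c oo (fps_X * gen_A 1 c))"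
    by (rule arg_cong[OF gen_A_fixed_point])
  moreover have "fps_nth (lagrange_kernel c) 0 \<noteq> 0"
    by (simp add: lagrange_kernel_def)
  ultimately have "of_nat (Suc n) * fps_nth (fps_X * gen_A 1 c) (Suc n) = fps_nth (lagrange_kernel c ^ Suc n) n"
    by (rule fps_lagrange_inversion)
  then show ?thesis by simp
qed

section \<open>Expansion of the powers of the kernel\<close>

lemma inverse_power_nth_multichoose:
  "fps_nth (inverse (1 - fps_const c * fps_X) ^ i) k = multichoose i k * c ^ k"
proof -
  have "inverse (1 - fps_const c * fps_X) ^ i = inverse ((1 - fps_X) ^ i) oo (fps_const c * fps_X)"
    by (simp add: fps_inverse_power fps_compose_power[symmetric] fps_inverse_compose fps_compose_sub_distrib)
  then show ?thesis
    by (simp only: multichoose_def fps_compose_linear fps_nth_Abs_fps) (rule mult.commute)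
qed

text \<open>The alternating sum arises from \<open>(1 + z)^m = (1 - z\<^sup>2)^m (1 - z)^(-m)\<close>.\<close>

lemma one_plus_fps_X_power_nth:
  "fps_nth ((1 + fps_X) ^ Suc p :: rat fps) r =
    (\<Sum>j=0..Suc p. (- 1) ^ j * of_nat (Suc p choose j) * of_nat (int_choose (int p + int r - 2 * int j) p))"
proof -
  let ?G = "inverse ((1 - fps_X) ^ Suc p) :: rat fps"
  have G: "fps_nth ?G s = of_nat ((p + s) choose p)" for s
    using one_minus_const_fps_X_neg_power'[of "Suc p" "1::rat"]
    by (simp add: binomial_symmetric[of s "p + s"])
  have shift: "fps_nth (fps_X ^ (2 * j) * ?G) r = of_nat (int_choose (int p + int r - 2 * int j) p)" for j
  \<comment> \<open>For \<open>r < 2 j\<close> the shifted coefficient is 0, and so is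
    \<open>int_choose\<close>, whose upper argument has fallen below \<open>p\<close>.\<close>
  proof (cases "r < 2 * j")
    case True
    then show ?thesis by (simp add: fps_X_power_mult_nth int_choose_def)
  next
    case False
    then have "nat (int p + int r - 2 * int j) = p + (r - 2 * j)"
      by linarith
    then show ?thesis
      using False by (simp only: fps_X_power_mult_nth int_choose_def G if_False) simp
  qed
  have unit: "(1 - fps_X) ^ Suc p * ?G = 1"
    by (intro inverse_mult_eq_1') simp
  have "(1 + fps_X :: rat fps) * (1 - fps_X) = 1 - fps_X ^ 2"
    by (simp add: algebra_simps power2_eq_square)
  then have "(1 - fps_X ^ 2) ^ Suc p * ?G = (1 + fps_X) ^ Suc p * ((1 - fps_X) ^ Suc p * ?G)"
    by (metis mult.assoc power_mult_distrib)
  then have "(1 + fps_X) ^ Suc p = (1 - fps_X ^ 2) ^ Suc p * ?G"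
    unfolding unit by simp
  also have "(1 - fps_X ^ 2 :: rat fps) ^ Suc p = (\<Sum>j\<le>Suc p. of_nat (Suc p choose j) * (- (fps_X ^ 2)) ^ j)"
    using binomial_ring[of "- (fps_X ^ 2)" "1 :: rat fps" "Suc p"] by simp
  also have "\<dots> = (\<Sum>j\<le>Suc p. fps_const ((- 1) ^ j * of_nat (Suc p choose j)) * fps_X ^ (2 * j))"
  proof (intro sum.cong refl)
    fix j
    have "(- (fps_X ^ 2)) ^ j = (- 1 :: rat fps) ^ j * fps_X ^ (2 * j)"
      by (subst power_minus) (simp only: power_mult)
    moreover have "fps_const ((- 1) ^ j * of_nat (Suc p choose j)) = (- 1 :: rat fps) ^ j * of_nat (Suc p choose j)"
      by (simp only: fps_const_mult[symmetric] fps_const_power[symmetric] fps_const_neg[symmetric]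
          fps_const_1_eq_1 fps_of_nat)
    ultimately show "of_nat (Suc p choose j) * (- (fps_X ^ 2)) ^ j =
        fps_const ((- 1) ^ j * of_nat (Suc p choose j)) * (fps_X :: rat fps) ^ (2 * j)"
      by (simp only: mult_ac)
  qed
  finally have "(1 + fps_X) ^ Suc p =
      (\<Sum>j\<le>Suc p. fps_const ((- 1) ^ j * of_nat (Suc p choose j)) * (fps_X ^ (2 * j) * ?G))"
    by (simp only: sum_distrib_right mult.assoc)
  then have "fps_nth ((1 + fps_X) ^ Suc p) r =
      (\<Sum>j\<le>Suc p. (- 1) ^ j * of_nat (Suc p choose j) * fps_nth (fps_X ^ (2 * j) * ?G) r)"
    by (simp only: fps_sum_nth fps_mult_left_const_nth)
  then show ?thesis
    by (simp only: shift atLeast0AtMost)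
qed

text \<open>The binomial theorem separates \<open>1 + z\<close> from
  \<open>z ^ 2 / (1 - c z)\<close>. Term \<open>i\<close> is divisible by \<open>z ^ (2 i)\<close>,
  which bounds \<open>i\<close> by \<open>n div 2\<close>, and powers of \<open>c\<close> come only
  from \<open>(1 - c z) ^ (- i)\<close>.\<close>

lemma lagrange_kernel_power_nth:
  "fps_nth (lagrange_kernel c ^ Suc n) n =
    (\<Sum>i=0..n div 2. of_nat (Suc n choose i) *
      (\<Sum>k\<le>n - 2 * i. multichoose i k * c ^ k * fps_nth ((1 + fps_X) ^ (Suc n - i)) (n - 2 * i - k)))"
proof -
  let ?I = "inverse (1 - fps_const c * fps_X)"
  have "lagrange_kernel c ^ Suc n =
      (\<Sum>i\<le>Suc n. of_nat (Suc n choose i) * (fps_X ^ 2 * ?I) ^ i * (1 + fps_X) ^ (Suc n - i))"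
    unfolding lagrange_kernel_def by (subst add.commute) (rule binomial_ring)
  also have "\<dots> = (\<Sum>i\<le>Suc n. fps_const (of_nat (Suc n choose i)) *
      (fps_X ^ (2 * i) * (?I ^ i * (1 + fps_X) ^ (Suc n - i))))"
    by (simp only: power_mult_distrib power_mult fps_of_nat mult.assoc)
  finally have "fps_nth (lagrange_kernel c ^ Suc n) n = (\<Sum>i\<le>Suc n. of_nat (Suc n choose i) *
      fps_nth (fps_X ^ (2 * i) * (?I ^ i * (1 + fps_X) ^ (Suc n - i))) n)"
    by (simp only: fps_sum_nth fps_mult_left_const_nth)
  also have "\<dots> = (\<Sum>i\<in>{0..n div 2}. of_nat (Suc n choose i) *
      fps_nth (fps_X ^ (2 * i) * (?I ^ i * (1 + fps_X) ^ (Suc n - i))) n)"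
    by (intro sum.mono_neutral_right) (auto simp: fps_X_power_mult_nth simp del: power_Suc binomial_Suc_Suc)
  also have "\<dots> = (\<Sum>i=0..n div 2. of_nat (Suc n choose i) *
      (\<Sum>k\<le>n - 2 * i. multichoose i k * c ^ k * fps_nth ((1 + fps_X) ^ (Suc n - i)) (n - 2 * i - k)))"
  proof (intro sum.cong refl arg_cong2[where f = "(*)"])
    fix i assume "i \<in> {0..n div 2}"
    then have "\<not> n < 2 * i" by auto
    then have "fps_nth (fps_X ^ (2 * i) * (?I ^ i * (1 + fps_X) ^ (Suc n - i))) n =
        fps_nth (?I ^ i * (1 + fps_X) ^ (Suc n - i)) (n - 2 * i)"
      by (simp only: fps_X_power_mult_nth if_False)
    also have "\<dots> = (\<Sum>k\<le>n - 2 * i. multichoose i k * c ^ k *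
        fps_nth ((1 + fps_X) ^ (Suc n - i)) (n - 2 * i - k))"
      unfolding fps_mult_nth inverse_power_nth_multichoose atLeast0AtMost ..
    finally show "fps_nth (fps_X ^ (2 * i) * (?I ^ i * (1 + fps_X) ^ (Suc n - i))) n =
      (\<Sum>k\<le>n - 2 * i. multichoose i k * c ^ k * fps_nth ((1 + fps_X) ^ (Suc n - i)) (n - 2 * i - k))" .
  qed
  finally show ?thesis .
qed

text \<open>The sign \<open>(- 1) ^ j\<close> and the factor \<open>(n + 1 - i) choose j\<close>
  arise together from \<open>(1 - z ^ 2) ^ (n + 1 - i)\<close>. With the sign
  \<open>(- 1) ^ (2 j)\<close> and without that factor, the value at \<open>n = 2\<close>,
  \<open>k = 0\<close> would be 10/3, whereas the coefficient is 2.\<close>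

definition gen_A_coeff :: "nat \<Rightarrow> nat \<Rightarrow> rat" where
  "gen_A_coeff n k = 1 / of_nat (n + 1) *
    (\<Sum>i = 0..n div 2. \<Sum>j = 0..n + 1 - i.
      (- 1) ^ j * of_nat ((n + 1) choose i) * of_nat ((n + 1 - i) choose j) * multichoose i k *
      of_nat (int_choose (2 * int n - 3 * int i - 2 * int j - int k) (n - i)))"

lemma gen_A_coeff_eq_0: "n < k \<Longrightarrow> gen_A_coeff n k = 0"
  unfolding gen_A_coeff_def
  by (intro mult_eq_0_iff[THEN iffD2] disjI2 sum.neutral ballI) (auto simp: int_choose_def)

lemma gen_A_nth_eq_sum:
  "fps_nth (gen_A 1 c) n = (\<Sum>k\<le>n. gen_A_coeff n k * c ^ k)"
proof -
  define T where "T i k = (\<Sum>j = 0..n + 1 - i. (- 1) ^ j * of_nat ((n + 1 - i) choose j) *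
      of_nat (int_choose (2 * int n - 3 * int i - 2 * int j - int k) (n - i)) :: rat)" for i k
  \<comment> \<open>The alternating sum with \<open>p = n - i\<close> and
    \<open>r = n - 2 i - k\<close>, so that \<open>p + r = 2 n - 3 i - k\<close>.\<close>
  have T: "fps_nth ((1 + fps_X) ^ (Suc n - i)) (n - 2 * i - k) = T i k"
    if "i \<le> n div 2" "k \<le> n - 2 * i" for i k
  proof -
    have "Suc n - i = Suc (n - i)" "n + 1 - i = Suc (n - i)"
      using that by linarith+
    moreover have "int (n - i) + int (n - 2 * i - k) - 2 * int j = 2 * int n - 3 * int i - 2 * int j - int k" for j
      using that by linarith
    ultimately show ?thesis
      unfolding T_def by (simp only: one_plus_fps_X_power_nth)
  qed
  \<comment> \<open>The zero convention of \<open>int_choose\<close> lets \<open>k\<close> range up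
    to \<open>n\<close> for every \<open>i\<close>, so that the sums over \<open>i\<close> and
    \<open>k\<close> can be swapped.\<close>
  have T0: "T i k = 0" if "i \<le> n div 2" "n - 2 * i < k" for i k
    unfolding T_def
  proof (intro sum.neutral ballI)
    fix j
    have "2 * int n - 3 * int i - 2 * int j - int k < int (n - i)"
      using that by linarith
    then show "(- 1) ^ j * of_nat ((n + 1 - i) choose j) *
      of_nat (int_choose (2 * int n - 3 * int i - 2 * int j - int k) (n - i)) = (0::rat)"
      by (simp add: int_choose_def)
  qed
  have "of_nat (Suc n) * fps_nth (gen_A 1 c) n =
      (\<Sum>i=0..n div 2. of_nat (Suc n choose i) * (\<Sum>k\<le>n. multichoose i k * c ^ k * T i k))"
    unfolding gen_A_nth_lagrange lagrange_kernel_power_nth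
  proof (rule sum.cong[OF refl])
    fix i assume i: "i \<in> {0..n div 2}"
    have "(\<Sum>k\<le>n - 2 * i. multichoose i k * c ^ k * fps_nth ((1 + fps_X) ^ (Suc n - i)) (n - 2 * i - k)) =
        (\<Sum>k\<le>n - 2 * i. multichoose i k * c ^ k * T i k)"
      using i by (intro sum.cong refl) (simp only: T atLeastAtMost_iff atMost_iff)
    also have "\<dots> = (\<Sum>k\<le>n. multichoose i k * c ^ k * T i k)"
      using i by (intro sum.mono_neutral_left) (auto simp: T0)
    finally show "of_nat (Suc n choose i) *
          (\<Sum>k\<le>n - 2 * i. multichoose i k * c ^ k * fps_nth ((1 + fps_X) ^ (Suc n - i)) (n - 2 * i - k)) =
        of_nat (Suc n choose i) * (\<Sum>k\<le>n. multichoose i k * c ^ k * T i k)"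
      by (rule arg_cong)
  qed
  also have "\<dots> = (\<Sum>k\<le>n. \<Sum>i=0..n div 2. of_nat (Suc n choose i) * multichoose i k * T i k * c ^ k)"
    unfolding sum_distrib_left by (subst sum.swap) (simp only: mult_ac)
  also have "\<dots> = (\<Sum>k\<le>n. of_nat (Suc n) * (gen_A_coeff n k * c ^ k))"
  proof (rule sum.cong[OF refl])
    fix k
    have "of_nat (Suc n) * gen_A_coeff n k = (\<Sum>i=0..n div 2. of_nat (Suc n choose i) * multichoose i k * T i k)"
      unfolding gen_A_coeff_def T_def sum_distrib_left Suc_eq_plus1
      by (simp add: mult_ac del: of_nat_Suc of_nat_add binomial_Suc_Suc)
    then show "(\<Sum>i=0..n div 2. of_nat (Suc n choose i) * multichoose i k * T i k * c ^ k) =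
        of_nat (Suc n) * (gen_A_coeff n k * c ^ k)"
      by (simp only: sum_distrib_right mult.assoc[symmetric])
  qed
  also have "\<dots> = of_nat (Suc n) * (\<Sum>k\<le>n. gen_A_coeff n k * c ^ k)"
    by (simp only: sum_distrib_left)
  finally show ?thesis
    by (simp del: of_nat_Suc)
qed

theorem coeff_gen_A:
  "coeff (fps_nth (gen_A (1 :: rat poly) [:0, 1:]) n) k = gen_A_coeff n k"
proof -
  let ?p = "fps_nth (gen_A (1 :: rat poly) [:0, 1:]) n"
  let ?q = "\<Sum>k\<le>n. monom (gen_A_coeff n k) k"
  have "poly ?p c = poly ?q c" for c
  proof -
    \<comment> \<open>Evaluation at \<open>c\<close> is a ring homomorphism, so it passes through
      the finite sum over avoiders. Agreement at all \<open>c\<close> suffices because the rationals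
      are infinite.\<close>
    have "poly ?p c = fps_nth (gen_A 1 c) n"
      unfolding gen_A_def by (simp add: poly_sum)
    then show ?thesis
      by (simp add: gen_A_nth_eq_sum poly_sum poly_monom)
  qed
  then have "?p = ?q"
    by (simp add: poly_eq_poly_eq_iff[symmetric] fun_eq_iff)
  also have "coeff ?q k = gen_A_coeff n k"
    by (cases "k \<le> n") (simp_all add: coeff_sum gen_A_coeff_eq_0 if_distrib cong: if_cong)
  finally show ?thesis .
qed

theorem theorem4:
  shows "(let t = fps_X; y = fps_const ind_y; x = fps_const ind_x in
            fps_to_fls (gen_A ind_y ind_x) =
              fps_to_fls
                (fps_sqrt (x ^ 2 * t ^ 2 + 2 * x * t * (t * y - 1) + t ^ 2 * (y - 4) * y
                    - 2 * t * y + 1)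
                  + x * t * (2 * t * y ^ 2 - 2 * (t + 1) * y + 1)
                  - 2 * t ^ 2 * (y - 1) * y + t * y - 1)
              / fps_to_fls (2 * t * y * (x * (t * y - 1) - t * y)))
    \<and> (\<forall>n k. coeff (fps_nth (gen_A (1 :: rat poly) [:0, 1:]) n) k =
          1 / of_nat (n + 1) *
          (\<Sum>i = 0..n div 2. \<Sum>j = 0..n + 1 - i.
             (- 1) ^ j * of_nat ((n + 1) choose i) * of_nat ((n + 1 - i) choose j)
               * multichoose i k
               * of_nat (int_choose (2 * int n - 3 * int i - 2 * int j - int k) (n - i))))"
  unfolding Let_def
  using gen_A_closed_form[OF ratfun_indeterminates] coeff_gen_A[unfolded gen_A_coeff_def]
  by (intro conjI allI)

end
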